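(* Let $R:\mathcal{P}\to\mathbb{R}$ be concave and $L$-smooth relative to the KL divergence for some $L>0$, i.e. for all $\pi,\pi'\in\mathcal{P}$, $$R[\pi']\le R[\pi]+\langle dR[\pi],\pi'-\pi\rangle,\qquad R[\pi']\ge R[\pi]+\langle dR[\pi],\pi'-\pi\rangle-L\cdot \mathrm{KL}[\pi'\mid\pi].$$ Let $\beta>0$, $\pi_{\mathrm{ref}}\in\mathcal{P}$, $\mathcal{L}[\pi]=-R[\pi]+\beta\,\mathrm{KL}[\pi\mid\pi_{\mathrm{ref}}]$, and let $\pi_*\in\mathcal{P}$ be the (unique) minimizer of $\mathcal{L}$ over $\mathcal{P}$. Let $T\ge1$ and let $\{\pi_t\}_{t=0}^{T}$ be the (random) sequence of policies generated by the inexact non-linear GRPO algorithm (defined in the context) with step size $\eta=1/L$ from an initial policy $\pi_0\in\mathcal{P}$. Assume that for some $\varepsilon,\delta\ge0$ and every $t\in\{0,\dots,T-1\}$, given $\pi_t$, the approximated first-order variation satisfies $$\mathbb{E}\left[\left\|\tfrac{\delta R}{\delta\pi}[\hat\pi_t]-\tfrac{\delta R}{\delta\pi}[\pi_t]\right\|_{\mathrm{sp}}^2\right]\le\varepsilon$$ and the optimization residual $r_t$ (defined in the context) satisfies $\mathbb{E}\left[\|r_t\|_{\mathrm{sp}}^2\right]\le\delta$. Let $\hat t\in\{1,\dots,T\}$ be a random index, independent of everything else, with $\mathbb{P}(\hat t=t)\propto\left(\frac{L+\beta/2}{L}\right)^t$. Then $$\mathbb{E}\left[\mathcal{L}[\pi_{\hat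 t}]-\mathcal{L}[\pi_*]\right]\le\frac{(\beta/2)\cdot\mathrm{KL}[\pi_*\mid\pi_0]}{\left((L+\beta/2)/L\right)^T-1}+\frac{2(\varepsilon+\delta)}{\beta},$$ where the expectation is over the randomness in the approximation of the functional derivative, the optimization procedure, and the choice of $\hat t$.
   Context: $\mathcal{Y}$ is the response space and $\mathcal{P}$ is the set of all policies, i.e. probability distributions $\pi$ on $\mathcal{Y}$, identified with their densities $\pi(y)$ (dependence on a prompt/context variable is suppressed). $\mathrm{KL}[\pi\mid\mu]=\mathbb{E}_{y\sim\pi}\left[\log\frac{\pi(y)}{\mu(y)}\right]$ is the Kullback–Leibler divergence. The span seminorm of $f:\mathcal{Y}\to\mathbb{R}$ is $\|f\|_{\mathrm{sp}}=\left(\sup_y f(y)-\inf_y f(y)\right)/2$. First-order variation: a map $\frac{\delta R}{\delta\pi}:\mathcal{P}\times\mathcal{Y}\to\mathbb{R}$ is the first-order variation of a functional $R:\mathcal{P}\to\mathbb{R}$ if for all $\pi,\pi'\in\mathcal{P}$, $\frac{d}{d\epsilon}R[\pi+\epsilon(\pi'-\pi)]\big|_{\epsilon=0}=\int\frac{\delta R}{\delta\pi}[\pi](y)\,(\pi'-\pi)(y)\,dy$; the derivative is taken from the right, since $\pi+\epsilon(\pi'-\pi)\in\mathcal{P}$ for $\epsilon\in[0,1]$. It is determined only up to additive constants. It is assumed to exist for all $\pi\in\mathcal{P}$, and its expression is also assumed to make sense (as a function on $\mathcal{Y}$) when evaluated at the empirical measures $\hat\pi_t$ below. Write $dR[\pi]=\frac{\delta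 R}{\delta\pi}[\pi]$ and $\langle dR[\pi],g\rangle=\int dR[\pi](y)\,g(y)\,dy$. Inexact non-linear GRPO with step size $\eta>0$: for $t=0,\dots,T-1$, draw i.i.d. samples $y_1,\dots,y_M\sim\pi_t$, let $\hat\pi_t=\frac1M\sum_{j=1}^M\delta_{y_j}$ be the empirical distribution, set $$\hat{\mathcal{L}}_t[\pi]=-\mathbb{E}_{y\sim\pi_t}\left[\frac{\pi(y)}{\pi_t(y)}\frac{\delta R}{\delta\pi}[\hat\pi_t](y)\right]+\beta\,\mathrm{KL}[\pi\mid\pi_{\mathrm{ref}}],$$ and let $\pi_{t+1}\in\mathcal{P}$ be a (possibly random) approximate minimizer of $\hat{\mathcal{L}}_t[\pi]+\frac1\eta\mathrm{KL}[\pi\mid\pi_t]$. The quality of the approximation is measured by the residual function on $\mathcal{Y}$ $$r_t:=\frac{\delta\hat{\mathcal{L}}_t}{\delta\pi}[\pi_{t+1}]+\frac1\eta\log\frac{\pi_{t+1}}{\pi_t}=-\frac{\delta R}{\delta\pi}[\hat\pi_t]+\beta\log\frac{\pi_{t+1}}{\pi_{\mathrm{ref}}}+\frac1\eta\log\frac{\pi_{t+1}}{\pi_t}\quad\text{(up to an additive constant)},$$ which is constant in $y$ when the minimization is exact. *)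

theory Defs
  imports "HOL-Probability.Probability"
begin

text \<open>
  The response space is a measure space \<open>\<nu>\<close> (the reference measure ``dy''). A policy is a
  probability density with respect to \<open>\<nu>\<close>; the distribution it stands for is \<open>law \<nu> p\<close>.
  Functionals of policies take the distribution as argument, so they do not see the choice of
  density and can also be evaluated at empirical measures, which in general have no density.
\<close>

definition law :: "'y measure \<Rightarrow> ('y \<Rightarrow> real) \<Rightarrow> 'y measure" where
  "law \<nu> p = density \<nu> (\<lambda>y. ennreal (p y))"

definition policies :: "'y measure \<Rightarrow> ('y \<Rightarrow> real) set" where
  "policies \<nu> = {p \<in> borel_measurable \<nu>. (\<forall>y\<in>space \<nu>. 0 \<le> p y) \<and> prob_space (law \<nu> p)}"

text \<open>
  \<open>KL_divergence\<close> has the reference measure first, and its Bochner integral is 0 when it does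
  not exist. For probability measures the negative part of the integrand is always integrable,
  so the remaining cases are exactly those where the divergence is infinite.
\<close>

definition KL :: "'y measure \<Rightarrow> 'y measure \<Rightarrow> ereal" where
  "KL P Q =
     (if absolutely_continuous Q P \<and> integrable P (entropy_density (exp 1) Q P)
      then ereal (KL_divergence (exp 1) Q P) else \<infinity>)"

text \<open>
  Infinite values are kept: the seminorm is \<open>\<infinity>\<close> for a function that is unbounded on \<open>A\<close> or
  takes an infinite value there.
\<close>

definition span_seminorm :: "'y set \<Rightarrow> ('y \<Rightarrow> ereal) \<Rightarrow> ennreal" where
  "span_seminorm A f = e2ennreal (((SUP y\<in>A. f y) - (INF y\<in>A. f y)) / 2)"

definition pairing :: "'y measure \<Rightarrow> ('y \<Rightarrow> real) \<Rightarrow> ('y \<Rightarrow> real) \<Rightarrow> real" where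
  "pairing \<nu> f g = (\<integral>y. f y * g y \<partial>\<nu>)"

definition first_order_variation ::
  "'y measure \<Rightarrow> ('y measure \<Rightarrow> real) \<Rightarrow> ('y measure \<Rightarrow> 'y \<Rightarrow> real) \<Rightarrow> bool" where
  "first_order_variation \<nu> R dR \<longleftrightarrow>
     (\<forall>p\<in>policies \<nu>. \<forall>q\<in>policies \<nu>.
        integrable (law \<nu> q) (dR (law \<nu> p)) \<and>
        ((\<lambda>e. R (law \<nu> (\<lambda>y. p y + e * (q y - p y)))) has_real_derivative
          pairing \<nu> (dR (law \<nu> p)) (\<lambda>y. q y - p y)) (at_right 0))"

definition concave_functional ::
  "'y measure \<Rightarrow> ('y measure \<Rightarrow> real) \<Rightarrow> ('y measure \<Rightarrow> 'y \<Rightarrow> real) \<Rightarrow> bool" where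
  "concave_functional \<nu> R dR \<longleftrightarrow>
     (\<forall>p\<in>policies \<nu>. \<forall>q\<in>policies \<nu>.
        R (law \<nu> q) \<le> R (law \<nu> p) + pairing \<nu> (dR (law \<nu> p)) (\<lambda>y. q y - p y))"

definition KL_smooth ::
  "'y measure \<Rightarrow> real \<Rightarrow> ('y measure \<Rightarrow> real) \<Rightarrow> ('y measure \<Rightarrow> 'y \<Rightarrow> real) \<Rightarrow> bool" where
  "KL_smooth \<nu> L R dR \<longleftrightarrow>
     (\<forall>p\<in>policies \<nu>. \<forall>q\<in>policies \<nu>.
        ereal (R (law \<nu> q)) \<ge>
          ereal (R (law \<nu> p) + pairing \<nu> (dR (law \<nu> p)) (\<lambda>y. q y - p y))
          - ereal L * KL (law \<nu> q) (law \<nu> p))"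

definition objective ::
  "'y measure \<Rightarrow> ('y measure \<Rightarrow> real) \<Rightarrow> real \<Rightarrow> ('y \<Rightarrow> real) \<Rightarrow> ('y \<Rightarrow> real) \<Rightarrow> ereal" where
  "objective \<nu> R \<beta> pref p = - ereal (R (law \<nu> p)) + ereal \<beta> * KL (law \<nu> p) (law \<nu> pref)"

definition is_minimizer ::
  "'y measure \<Rightarrow> ('y measure \<Rightarrow> real) \<Rightarrow> real \<Rightarrow> ('y \<Rightarrow> real) \<Rightarrow> ('y \<Rightarrow> real) \<Rightarrow> bool" where
  "is_minimizer \<nu> R \<beta> pref p \<longleftrightarrow>
     p \<in> policies \<nu> \<and> (\<forall>q\<in>policies \<nu>. objective \<nu> R \<beta> pref p \<le> objective \<nu> R \<beta> pref q)"

definition empirical :: "'y measure \<Rightarrow> nat \<Rightarrow> (nat \<Rightarrow> 'y) \<Rightarrow> 'y measure" where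
  "empirical \<nu> M ys = distr (uniform_count_measure {..<M}) \<nu> ys"

text \<open>
  Logarithm of the ratio \<open>a / b\<close> of two nonnegative numbers in the extended reals. The value at
  \<open>0 / 0\<close> is irrelevant, see \<open>residual_dom\<close>.
\<close>

definition log_ratio :: "real \<Rightarrow> real \<Rightarrow> ereal" where
  "log_ratio a b = (if a = 0 then - \<infinity> else if b = 0 then \<infinity> else ereal (ln (a / b)))"

text \<open>
  The residual of \<open>p'\<close> as an approximate minimizer over \<open>p\<close> of the regularized surrogate
  \<open>- E\<^bsub>y\<sim>pt\<^esub>[p y / pt y * g y] + \<beta> KL[p | pref] + (1/\<eta>) KL[p | pt]\<close>, where \<open>g\<close> is the
  first-order variation of the reward functional at the empirical measure; the importance-weighted
  expectation is \<open>\<integral>y. g y * p y \<partial>\<nu>\<close> when \<open>KL[p | pt]\<close> is finite. So the residual is the first-order variation of the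
  surrogate at \<open>p'\<close>, without the additive constant \<open>\<beta> + 1/\<eta>\<close>, which the span seminorm ignores.
\<close>

definition residual ::
  "('y \<Rightarrow> real) \<Rightarrow> real \<Rightarrow> real \<Rightarrow> ('y \<Rightarrow> real) \<Rightarrow> ('y \<Rightarrow> real) \<Rightarrow> ('y \<Rightarrow> real) \<Rightarrow> 'y \<Rightarrow> ereal" where
  "residual g \<beta> \<eta> pref pt p' y =
     - ereal (g y) + ereal \<beta> * log_ratio (p' y) (pref y)
     + ereal (1 / \<eta>) * log_ratio (p' y) (pt y)"

text \<open>
  The responses at which the residual is meaningful: the whole space when the densities are
  positive. The points left out are those with \<open>p' y = 0\<close> at which \<open>p' y / pref y\<close> or
  \<open>p' y / pt y\<close> is \<open>0 / 0\<close>; every policy with finite surrogate objective vanishes there almost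
  everywhere.
\<close>

definition residual_dom ::
  "'y measure \<Rightarrow> ('y \<Rightarrow> real) \<Rightarrow> ('y \<Rightarrow> real) \<Rightarrow> ('y \<Rightarrow> real) \<Rightarrow> 'y set" where
  "residual_dom \<nu> pref pt p' = {y \<in> space \<nu>. 0 < p' y \<or> (0 < pref y \<and> 0 < pt y)}"

definition var_error ::
  "'y measure \<Rightarrow> ('y measure \<Rightarrow> 'y \<Rightarrow> real) \<Rightarrow> nat \<Rightarrow> (nat \<Rightarrow> 'y) \<Rightarrow> ('y \<Rightarrow> real) \<Rightarrow> ennreal" where
  "var_error \<nu> dR M ys pt =
     span_seminorm (space \<nu>) (\<lambda>y. ereal (dR (empirical \<nu> M ys) y - dR (law \<nu> pt) y))"

definition opt_error ::
  "'y measure \<Rightarrow> ('y measure \<Rightarrow> 'y \<Rightarrow> real) \<Rightarrow> real \<Rightarrow> real \<Rightarrow> ('y \<Rightarrow> real) \<Rightarrow>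
   nat \<Rightarrow> (nat \<Rightarrow> 'y) \<Rightarrow> ('y \<Rightarrow> real) \<Rightarrow> ('y \<Rightarrow> real) \<Rightarrow> ennreal" where
  "opt_error \<nu> dR \<beta> \<eta> pref M ys pt p' =
     span_seminorm (residual_dom \<nu> pref pt p')
       (residual (dR (empirical \<nu> M ys)) \<beta> \<eta> pref pt p')"

text \<open>
  The stochastic process of the algorithm. The sigma-algebra \<open>F t\<close> is the history up to the
  choice of \<open>\<pi> t\<close>, and \<open>Y t \<omega> j\<close> for \<open>j < M\<close> are the samples of round \<open>t\<close>, which are
  conditionally i.i.d. with law \<open>\<pi> t\<close> given \<open>F t\<close>. The next policy may depend in any measurable
  way on the history, the samples and additional randomness; its quality as an approximate
  minimizer is not constrained here but measured by \<open>opt_error\<close>.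
\<close>

definition sampling_process ::
  "'w measure \<Rightarrow> (nat \<Rightarrow> 'w measure) \<Rightarrow> 'y measure \<Rightarrow> nat \<Rightarrow> nat \<Rightarrow> ('y \<Rightarrow> real) \<Rightarrow>
   (nat \<Rightarrow> 'w \<Rightarrow> 'y \<Rightarrow> real) \<Rightarrow> (nat \<Rightarrow> 'w \<Rightarrow> nat \<Rightarrow> 'y) \<Rightarrow> bool" where
  "sampling_process Pr F \<nu> M T p0 \<pi> Y \<longleftrightarrow>
     filtration (space Pr) F \<and> (\<forall>t. subalgebra Pr (F t)) \<and>
     (\<forall>\<omega>\<in>space Pr. \<pi> 0 \<omega> = p0) \<and>
     (\<forall>t\<le>T. (\<forall>\<omega>\<in>space Pr. \<pi> t \<omega> \<in> policies \<nu>) \<and>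
        (\<lambda>(\<omega>, y). \<pi> t \<omega> y) \<in> borel_measurable (F t \<Otimes>\<^sub>M \<nu>)) \<and>
     (\<forall>t<T.
        (\<forall>j<M. (\<lambda>\<omega>. Y t \<omega> j) \<in> measurable (F (Suc t)) \<nu>) \<and>
        (\<forall>A. (\<forall>j<M. A j \<in> sets \<nu>) \<longrightarrow>
           (AE \<omega> in Pr.
              real_cond_exp Pr (F t) (indicator {\<omega>' \<in> space Pr. \<forall>j<M. Y t \<omega>' j \<in> A j}) \<omega> =
              (\<Prod>j<M. measure (law \<nu> (\<pi> t \<omega>)) (A j)))))"

text \<open>The sigma-algebra on the probability space generated by a random policy.\<close>

definition sigma_policy :: "'w measure \<Rightarrow> 'y measure \<Rightarrow> ('w \<Rightarrow> 'y \<Rightarrow> real) \<Rightarrow> 'w measure" where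
  "sigma_policy Pr \<nu> p = vimage_algebra (space Pr) (\<lambda>\<omega>. law \<nu> (p \<omega>)) (prob_algebra \<nu>)"

end

theory Submission
  imports Defs
begin

text \<open>
  One step satisfies, with \<open>s\<close> the sum of the two error seminorms,
  \<open>\<L>[\<pi>\<^sub>t\<^sub>+\<^sub>1] - \<L>[\<pi>\<^sub>*] + (L + \<beta>/2) KL[\<pi>\<^sub>* | \<pi>\<^sub>t\<^sub>+\<^sub>1] \<le> L KL[\<pi>\<^sub>* | \<pi>\<^sub>t] + s\<^sup>2 / \<beta>\<close>:
  concavity, smoothness and the three-point identity leave only the pairing of the error function
  with \<open>\<pi>\<^sub>* - \<pi>\<^sub>t\<^sub>+\<^sub>1\<close>, and half of the gained \<open>\<beta> KL[\<pi>\<^sub>* | \<pi>\<^sub>t\<^sub>+\<^sub>1]\<close> absorbs it. Since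
  \<open>L + \<beta>/2 = L \<rho>\<close> for \<open>\<rho> = (L + \<beta>/2) / L\<close>, the expectations telescope under the weights
  \<open>\<rho>\<^sup>t\<close>. All quantities are kept in \<open>[0, \<infinity>]\<close>, so the step inequality needs no
  finiteness hypotheses.
\<close>

section \<open>Policies and their divergences in terms of densities\<close>

lemma policiesD:
  assumes "p \<in> policies \<nu>"
  shows "p \<in> borel_measurable \<nu>" "\<And>y. y \<in> space \<nu> \<Longrightarrow> 0 \<le> p y" "prob_space (law \<nu> p)"
  using assms by (auto simp: policies_def)

lemma integrable_law_iff:
  assumes "p \<in> policies \<nu>" "f \<in> borel_measurable \<nu>"
  shows "integrable (law \<nu> p) f \<longleftrightarrow> integrable \<nu> (\<lambda>y. p y * f y)"
  using policiesD[OF assms(1)] assms(2) unfolding law_def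
  by (subst integrable_density) auto

lemma integral_law:
  fixes f :: "'y \<Rightarrow> real"
  assumes "p \<in> policies \<nu>" "f \<in> borel_measurable \<nu>"
  shows "integral\<^sup>L (law \<nu> p) f = (\<integral>y. p y * f y \<partial>\<nu>)"
  using policiesD[OF assms(1)] assms(2) unfolding law_def
  by (subst integral_density) auto

lemma policy_nn_integral:
  assumes "p \<in> policies \<nu>"
  shows "(\<integral>\<^sup>+ y. ennreal (p y) \<partial>\<nu>) = 1"
proof -
  have "emeasure (law \<nu> p) (space \<nu>) = 1"
    using prob_space.emeasure_space_1[OF policiesD(3)[OF assms]] by (simp add: law_def)
  with policiesD[OF assms] show ?thesis
    by (simp add: law_def emeasure_density nn_integral_set_ennreal cong: nn_integral_cong)
qed

lemma policy_integrable:
  assumes "p \<in> policies \<nu>"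
  shows "integrable \<nu> p" "(\<integral>y. p y \<partial>\<nu>) = 1"
proof -
  have "has_bochner_integral \<nu> p 1"
    using policiesD[OF assms] policy_nn_integral[OF assms]
    by (intro has_bochner_integral_nn_integral) auto
  then show "integrable \<nu> p" "(\<integral>y. p y \<partial>\<nu>) = 1"
    by (auto simp: has_bochner_integral_iff)
qed

text \<open>Up to null sets, the zero set of \<open>q\<close> is the largest null set of
  \<open>law \<nu> q\<close>, so null sets only have to be compared there.\<close>

lemma absolutely_continuous_law_iff:
  assumes "p \<in> policies \<nu>" "q \<in> policies \<nu>"
  shows "absolutely_continuous (law \<nu> q) (law \<nu> p) \<longleftrightarrow> (AE y in \<nu>. q y = 0 \<longrightarrow> p y = 0)"
proof
  note [measurable] = policiesD(1)[OF assms(1)] policiesD(1)[OF assms(2)]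
  assume ac: "absolutely_continuous (law \<nu> q) (law \<nu> p)"
  have "{y \<in> space \<nu>. q y = 0} \<in> null_sets (law \<nu> q)"
    unfolding law_def by (subst null_sets_density_iff) auto
  with ac have "{y \<in> space \<nu>. q y = 0} \<in> null_sets (law \<nu> p)"
    by (auto simp: absolutely_continuous_def)
  then have "AE y in \<nu>. y \<in> {y \<in> space \<nu>. q y = 0} \<longrightarrow> ennreal (p y) = 0"
    unfolding law_def by (subst (asm) null_sets_density_iff) auto
  then show "AE y in \<nu>. q y = 0 \<longrightarrow> p y = 0"
    using AE_space by eventually_elim (use policiesD(2)[OF assms(1)] in \<open>auto simp: ennreal_eq_0_iff intro: antisym\<close>)
next
  note [measurable] = policiesD(1)[OF assms(1)] policiesD(1)[OF assms(2)]
  assume *: "AE y in \<nu>. q y = 0 \<longrightarrow> p y = 0"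
  show "absolutely_continuous (law \<nu> q) (law \<nu> p)"
    unfolding absolutely_continuous_def
  proof
    fix N assume "N \<in> null_sets (law \<nu> q)"
    then have N: "N \<in> sets \<nu>" "AE y in \<nu>. y \<in> N \<longrightarrow> ennreal (q y) = 0"
      unfolding law_def by (auto simp: null_sets_density_iff)
    from N(2) * AE_space have "AE y in \<nu>. y \<in> N \<longrightarrow> ennreal (p y) = 0"
      by eventually_elim (use policiesD(2)[OF assms(2)] in \<open>auto simp: ennreal_eq_0_iff intro: antisym\<close>)
    with N(1) show "N \<in> null_sets (law \<nu> p)"
      unfolding law_def by (subst null_sets_density_iff) auto
  qed
qed

text \<open>Where \<open>q\<close> is positive, the Radon-Nikodym derivative is almost everywhere
  \<open>p / q\<close>; where \<open>q\<close> vanishes so does \<open>p\<close>, and both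
  integrands are 0. Replacing the derivative by the quotient turns the divergence into an integral
  over \<open>\<nu>\<close> that can be split and rearranged.\<close>

lemma KL_law:
  assumes p: "p \<in> policies \<nu>" and q: "q \<in> policies \<nu>"
  shows "KL (law \<nu> p) (law \<nu> q) =
    (if (AE y in \<nu>. q y = 0 \<longrightarrow> p y = 0) \<and> integrable \<nu> (\<lambda>y. p y * ln (p y / q y))
     then ereal (\<integral>y. p y * ln (p y / q y) \<partial>\<nu>) else \<infinity>)"
proof (cases "AE y in \<nu>. q y = 0 \<longrightarrow> p y = 0")
  case False
  then show ?thesis
    by (simp add: KL_def absolutely_continuous_law_iff[OF assms])
next
  case True
  note [measurable] = policiesD(1)[OF p] policiesD(1)[OF q]
  let ?Q = "law \<nu> q" and ?P = "law \<nu> p"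
  interpret Q: prob_space ?Q using policiesD(3)[OF q] .
  have eq: "density ?Q (\<lambda>y. ennreal (p y / q y)) = ?P"
    unfolding law_def
    using policiesD[OF p] policiesD[OF q] True
    by (intro density_density_divide) auto
  have "AE y in ?Q. ennreal (p y / q y) = RN_deriv ?Q ?P y"
    by (rule Q.RN_deriv_unique[OF _ eq]) (simp add: law_def)
  then have "AE y in \<nu>. 0 < ennreal (q y) \<longrightarrow> ennreal (p y / q y) = RN_deriv ?Q ?P y"
    unfolding law_def by (subst (asm) AE_density) auto
  then have AE: "AE y in \<nu>. p y * entropy_density (exp 1) ?Q ?P y = p y * ln (p y / q y)"
    using True AE_space
  proof eventually_elim
    case (elim y)
    show ?case
    proof (cases "q y = 0")
      case False
      with elim policiesD(2)[OF q, of y] have "0 < q y" by auto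
      with elim policiesD(2)[OF p, of y] have "enn2real (RN_deriv ?Q ?P y) = p y / q y"
        by (metis (no_types, lifting) divide_nonneg_pos enn2real_ennreal ennreal_less_zero_iff)
      then show ?thesis
        by (simp add: entropy_density_def comp_def log_def)
    qed (use elim in auto)
  qed
  have [measurable]: "entropy_density (exp 1) ?Q ?P \<in> borel_measurable \<nu>"
    using measurable_entropy_density[of "exp 1" ?Q ?P] by (simp add: law_def)
  have "integrable ?P (entropy_density (exp 1) ?Q ?P) \<longleftrightarrow> integrable \<nu> (\<lambda>y. p y * ln (p y / q y))"
    by (subst integrable_law_iff[OF p]; simp?) (rule integrable_cong_AE[OF _ _ AE]; measurable)
  moreover have "KL_divergence (exp 1) ?Q ?P = (\<integral>y. p y * ln (p y / q y) \<partial>\<nu>)"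
    unfolding KL_divergence_def
    by (subst integral_law[OF p]; simp?) (rule integral_cong_AE[OF _ _ AE]; measurable)
  ultimately show ?thesis
    using True by (simp add: KL_def absolutely_continuous_law_iff[OF assms])
qed

text \<open>This is \<open>ln x \<le> x - 1\<close> at \<open>x = b / a\<close>. It makes the
  integrand of the divergence nonnegative up to linear terms, and it also yields integrable lower
  bounds and the Gibbs inequality.\<close>

lemma mult_ln_ge:
  fixes a b :: real
  assumes "0 \<le> a" "0 \<le> b" "b = 0 \<longrightarrow> a = 0"
  shows "a - b \<le> a * ln (a / b)"
proof (cases "a = 0")
  case False
  with assms have ab: "0 < a" "0 < b" by auto
  then have "ln (b / a) \<le> b / a - 1"
    by (intro ln_le_minus_one) auto
  with ab have "a * ln (b / a) \<le> b - a"
    by (auto simp: field_simps)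
  with ab show ?thesis by (simp add: ln_div algebra_simps)
qed (use assms in auto)

text \<open>The linear terms integrate to 0 over a pair of densities and make the integrand nonnegative,
  so that the divergence is measurable in the densities by Tonelli.\<close>

definition kl_fun :: "real \<Rightarrow> real \<Rightarrow> ennreal" where
  "kl_fun a b = (if b = 0 \<and> a \<noteq> 0 then \<infinity> else ennreal (a * ln (a / b) - a + b))"

lemma measurable_kl_fun [measurable (raw)]:
  assumes [measurable]: "f \<in> borel_measurable N" "g \<in> borel_measurable N"
  shows "(\<lambda>x. kl_fun (f x) (g x)) \<in> borel_measurable N"
  unfolding kl_fun_def by measurable

text \<open>The added terms \<open>q - p\<close> have integral 0. Both causes of an infinite
  divergence, failing absolute continuity and failing integrability, show up as an infinite integral
  of the nonnegative \<open>kl_fun\<close>.\<close>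

lemma KL_law_nn_integral:
  assumes p: "p \<in> policies \<nu>" and q: "q \<in> policies \<nu>"
  shows "KL (law \<nu> p) (law \<nu> q) = enn2ereal (\<integral>\<^sup>+ y. kl_fun (p y) (q y) \<partial>\<nu>)"
proof -
  note [measurable] = policiesD(1)[OF p] policiesD(1)[OF q]
  show ?thesis
  proof (cases "AE y in \<nu>. q y = 0 \<longrightarrow> p y = 0")
    case False
    have "(\<integral>\<^sup>+ y. kl_fun (p y) (q y) \<partial>\<nu>) = \<infinity>"
    proof (rule ccontr)
      assume "(\<integral>\<^sup>+ y. kl_fun (p y) (q y) \<partial>\<nu>) \<noteq> \<infinity>"
      then have "AE y in \<nu>. kl_fun (p y) (q y) \<noteq> \<infinity>"
        by (intro nn_integral_PInf_AE) auto
      then have "AE y in \<nu>. q y = 0 \<longrightarrow> p y = 0"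
        by eventually_elim (auto simp: kl_fun_def split: if_splits)
      with False show False by blast
    qed
    with False show ?thesis by (simp add: KL_law[OF assms])
  next
    case True
    let ?f = "\<lambda>y. p y * ln (p y / q y) - p y + q y"
    have nonneg: "AE y in \<nu>. 0 \<le> ?f y"
      using True AE_space
    proof eventually_elim
      case (elim y)
      then show ?case
        using mult_ln_ge[OF policiesD(2)[OF p, of y] policiesD(2)[OF q, of y]] by simp
    qed
    have eq: "(\<integral>\<^sup>+ y. kl_fun (p y) (q y) \<partial>\<nu>) = (\<integral>\<^sup>+ y. ennreal (?f y) \<partial>\<nu>)"
      using True by (intro nn_integral_cong_AE, eventually_elim) (simp add: kl_fun_def)
    have iff: "integrable \<nu> ?f \<longleftrightarrow> integrable \<nu> (\<lambda>y. p y * ln (p y / q y))"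
    proof
      assume "integrable \<nu> ?f"
      from Bochner_Integration.integrable_diff[OF Bochner_Integration.integrable_add[OF this
          policy_integrable(1)[OF p]] policy_integrable(1)[OF q]]
      show "integrable \<nu> (\<lambda>y. p y * ln (p y / q y))" by simp
    next
      assume "integrable \<nu> (\<lambda>y. p y * ln (p y / q y))"
      from Bochner_Integration.integrable_add[OF Bochner_Integration.integrable_diff[OF this
          policy_integrable(1)[OF p]] policy_integrable(1)[OF q]]
      show "integrable \<nu> ?f" .
    qed
    show ?thesis
    proof (cases "integrable \<nu> ?f")
      case int: True
      have "(\<integral>\<^sup>+ y. ennreal (?f y) \<partial>\<nu>) = ennreal (\<integral>y. ?f y \<partial>\<nu>)"
        by (rule nn_integral_eq_integral[OF int nonneg])
      moreover have "(\<integral>y. ?f y \<partial>\<nu>) = (\<integral>y. p y * ln (p y / q y) \<partial>\<nu>)"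
        using int iff policy_integrable[OF p] policy_integrable[OF q] by simp
      moreover have "0 \<le> (\<integral>y. ?f y \<partial>\<nu>)"
        using nonneg by (rule integral_nonneg_AE)
      ultimately show ?thesis
        using True int iff by (simp add: KL_law[OF assms] eq enn2ereal_ennreal)
    next
      case False
      have "(\<integral>\<^sup>+ y. ennreal (?f y) \<partial>\<nu>) = \<infinity>"
      proof (rule ccontr)
        assume "(\<integral>\<^sup>+ y. ennreal (?f y) \<partial>\<nu>) \<noteq> \<infinity>"
        then have "integrable \<nu> ?f"
          using nonneg by (intro integrableI_nonneg) (auto simp: top.not_eq_extremum)
        with False show False by blast
      qed
      with False iff show ?thesis
        by (simp add: KL_law[OF assms] eq)
    qed
  qed
qed

lemma KL_law_finite:
  assumes "p \<in> policies \<nu>" "q \<in> policies \<nu>" "KL (law \<nu> p) (law \<nu> q) \<noteq> \<infinity>"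
  shows "AE y in \<nu>. q y = 0 \<longrightarrow> p y = 0"
    and "integrable \<nu> (\<lambda>y. p y * ln (p y / q y))"
    and "KL (law \<nu> p) (law \<nu> q) = ereal (\<integral>y. p y * ln (p y / q y) \<partial>\<nu>)"
  using assms(3) unfolding KL_law[OF assms(1,2)] by (auto split: if_splits)

section \<open>Differences of means bounded by the divergence\<close>

lemma integrable_mult_bounded_on_support:
  fixes p h :: "'y \<Rightarrow> real"
  assumes p: "p \<in> policies \<nu>" and [measurable]: "h \<in> borel_measurable \<nu>"
    and h: "AE y in \<nu>. p y \<noteq> 0 \<longrightarrow> h y \<in> {a..b}"
  shows "integrable \<nu> (\<lambda>y. p y * h y)"
proof (rule Bochner_Integration.integrable_bound)
  note [measurable] = policiesD(1)[OF p]
  \<comment> \<open>The product is dominated by a multiple of \<open>p\<close>. Off the support of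
    \<open>p\<close> it vanishes, so \<open>h\<close> may be arbitrary there; this matters when
    \<open>h\<close> contains logarithms of ratios of densities.\<close>
  show "integrable \<nu> (\<lambda>y. p y * max \<bar>a\<bar> \<bar>b\<bar>)"
    using policy_integrable[OF p] by simp
  show "(\<lambda>y. p y * h y) \<in> borel_measurable \<nu>" by measurable
  show "AE y in \<nu>. norm (p y * h y) \<le> norm (p y * max \<bar>a\<bar> \<bar>b\<bar>)"
    using h
  proof eventually_elim
    case (elim y)
    show ?case
    proof (cases "p y = 0")
      case False
      with elim have "\<bar>h y\<bar> \<le> max \<bar>a\<bar> \<bar>b\<bar>" by auto
      then show ?thesis by (simp add: abs_mult mult_left_mono)
    qed simp
  qed
qed

text \<open>Gibbs' variational inequality combined with Hoeffding's lemma; for all \<open>l\<close> together this is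
  Pinsker's inequality after Young's inequality.\<close>

lemma integral_diff_le_KL:
  fixes p q h :: "'y \<Rightarrow> real"
  assumes p: "p \<in> policies \<nu>" and q: "q \<in> policies \<nu>" and [measurable]: "h \<in> borel_measurable \<nu>"
    and h: "AE y in \<nu>. q y \<noteq> 0 \<longrightarrow> h y \<in> {a..b}"
    and ac: "AE y in \<nu>. q y = 0 \<longrightarrow> p y = 0"
    and int: "integrable \<nu> (\<lambda>y. p y * ln (p y / q y))"
    and "0 < l"
  shows "l * ((\<integral>y. p y * h y \<partial>\<nu>) - (\<integral>y. q y * h y \<partial>\<nu>)) \<le>
    (\<integral>y. p y * ln (p y / q y) \<partial>\<nu>) + l\<^sup>2 * (b - a)\<^sup>2 / 8"
proof -
  note [measurable] = policiesD(1)[OF p] policiesD(1)[OF q]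
  let ?Q = "law \<nu> q"
  define \<mu> where "\<mu> = (\<integral>y. q y * h y \<partial>\<nu>)"
  \<comment> \<open>\<open>c\<close> is Hoeffding's bound for the logarithm of the mean of
    \<open>exp (l * (h - \<mu>))\<close> under \<open>q\<close>.\<close>
  define c where "c = l\<^sup>2 * (b - a)\<^sup>2 / 8"
  have hp: "AE y in \<nu>. p y \<noteq> 0 \<longrightarrow> h y \<in> {a..b}"
    using h ac by eventually_elim auto
  have ph: "integrable \<nu> (\<lambda>y. p y * h y)"
    by (rule integrable_mult_bounded_on_support[OF p _ hp]) auto
  interpret Q: prob_space ?Q using policiesD(3)[OF q] .
  interpret interval_bounded_random_variable ?Q h a b
  proof unfold_locales
    show "h \<in> borel_measurable ?Q" by (simp add: law_def)
    show "AE y in ?Q. h y \<in> {a..b}"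
      unfolding law_def using h by (subst AE_density) (auto elim: eventually_mono)
  qed
  have E: "Q.expectation h = \<mu>" unfolding \<mu>_def by (rule integral_law[OF q]) simp
  let ?g = "\<lambda>y. q y * exp (l * (h y - \<mu>))"
  have "(\<integral>\<^sup>+ y. ennreal (exp (l * (h y - \<mu>))) \<partial>?Q) \<le> ennreal (exp c)"
    using Hoeffdings_lemma_nn_integral[OF \<open>0 < l\<close>] unfolding E c_def .
  also have "(\<integral>\<^sup>+ y. ennreal (exp (l * (h y - \<mu>))) \<partial>?Q) = (\<integral>\<^sup>+ y. ennreal (?g y) \<partial>\<nu>)"
  proof -
    have "(\<integral>\<^sup>+ y. ennreal (exp (l * (h y - \<mu>))) \<partial>?Q) =
        (\<integral>\<^sup>+ y. ennreal (q y) * ennreal (exp (l * (h y - \<mu>))) \<partial>\<nu>)"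
      unfolding law_def by (rule nn_integral_density) measurable
    also have "\<dots> = (\<integral>\<^sup>+ y. ennreal (?g y) \<partial>\<nu>)"
      by (rule nn_integral_cong) (simp add: ennreal_mult policiesD(2)[OF q])
    finally show ?thesis .
  qed
  finally have nn: "(\<integral>\<^sup>+ y. ennreal (?g y) \<partial>\<nu>) \<le> ennreal (exp c)" .
  have g: "integrable \<nu> ?g"
    using nn policiesD(2)[OF q] by (intro integrableI_nonneg) (auto simp: le_less_trans)
  have gle: "(\<integral>y. ?g y \<partial>\<nu>) \<le> exp c"
  proof -
    have "ennreal (\<integral>y. ?g y \<partial>\<nu>) = (\<integral>\<^sup>+ y. ennreal (?g y) \<partial>\<nu>)"
      by (rule nn_integral_eq_integral[symmetric, OF g]) (use policiesD(2)[OF q] in auto)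
    with nn have "ennreal (\<integral>y. ?g y \<partial>\<nu>) \<le> ennreal (exp c)" by (simp only:)
    then show ?thesis by (subst (asm) ennreal_le_iff) auto
  qed
  have "(\<integral>y. l * (p y * h y) - (l * \<mu> + c) * p y - p y * ln (p y / q y) \<partial>\<nu>)
      \<le> (\<integral>y. exp (- c) * ?g y - p y \<partial>\<nu>)"
  proof (rule integral_mono_AE)
    show "AE y in \<nu>. l * (p y * h y) - (l * \<mu> + c) * p y - p y * ln (p y / q y)
        \<le> exp (- c) * ?g y - p y"
      using ac AE_space
    proof eventually_elim
      case (elim y)
      \<comment> \<open>\<open>q y * exp e\<close> is the density \<open>q\<close> tilted by
        \<open>h\<close>, scaled by the bound \<open>exp c\<close> in place of its exact normalizing
        constant. Its mass is thus at most 1, which is enough for an upper bound.\<close>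
      define e where "e = l * (h y - \<mu>) - c"
      have nonneg: "0 \<le> p y" "0 \<le> q y"
        using elim policiesD(2)[OF p] policiesD(2)[OF q] by auto
      have "p y - q y * exp e \<le> p y * ln (p y / (q y * exp e))"
        using nonneg elim by (intro mult_ln_ge) auto
      also have "\<dots> = p y * ln (p y / q y) - p y * e"
      proof (cases "p y = 0")
        case False
        with nonneg elim have "0 < p y" "0 < q y" by (auto simp: less_le)
        then show ?thesis by (simp add: ln_div ln_mult algebra_simps)
      qed auto
      finally have "p y - q y * exp e \<le> p y * ln (p y / q y) - p y * e" .
      moreover have "q y * exp e = exp (- c) * ?g y"
        by (simp add: e_def exp_diff exp_minus divide_inverse mult_ac)
      moreover have "p y * e = l * (p y * h y) - (l * \<mu> + c) * p y"
        by (simp add: e_def algebra_simps)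
      ultimately show ?case by linarith
    qed
    show "integrable \<nu> (\<lambda>y. l * (p y * h y) - (l * \<mu> + c) * p y - p y * ln (p y / q y))"
      using ph int policy_integrable[OF p] by auto
    show "integrable \<nu> (\<lambda>y. exp (- c) * ?g y - p y)"
      using g policy_integrable[OF p] by auto
  qed
  also have "(\<integral>y. l * (p y * h y) - (l * \<mu> + c) * p y - p y * ln (p y / q y) \<partial>\<nu>)
      = l * (\<integral>y. p y * h y \<partial>\<nu>) - (l * \<mu> + c) - (\<integral>y. p y * ln (p y / q y) \<partial>\<nu>)"
    using ph int policy_integrable[OF p] by simp
  also have "(\<integral>y. exp (- c) * ?g y - p y \<partial>\<nu>) = exp (- c) * (\<integral>y. ?g y \<partial>\<nu>) - 1"
    using g policy_integrable[OF p] by simp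
  also have "\<dots> \<le> exp (- c) * exp c - 1"
    using gle by (intro diff_right_mono mult_left_mono) auto
  also have "\<dots> = 0" by (simp flip: exp_add)
  finally show ?thesis by (simp add: \<mu>_def c_def algebra_simps)
qed

section \<open>From finite errors to the inequality for one step\<close>

lemma span_seminorm_finite:
  assumes "A \<noteq> {}" "span_seminorm A f \<noteq> \<top>"
  obtains c s where "0 \<le> s" "span_seminorm A f = ennreal s"
    "\<And>y. y \<in> A \<Longrightarrow> ereal c \<le> f y \<and> f y \<le> ereal (c + 2 * s)"
proof -
  let ?S = "SUP y\<in>A. f y" and ?I = "INF y\<in>A. f y"
  have "?I \<le> ?S"
    using assms(1) by (rule INF_le_SUP)
  \<comment> \<open>In \<open>ereal\<close> the difference of two equal infinities is
    \<open>\<infinity>\<close>, so a finite seminorm also excludes a function that is constantly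
    infinite, and both extrema are real.\<close>
  moreover have "?S - ?I \<noteq> \<infinity>"
    using assms(2) by (auto simp: span_seminorm_def e2ennreal_infty)
  ultimately obtain c d where SI: "?I = ereal c" "?S = ereal d" "c \<le> d"
    using assms(1) by (cases ?I; cases ?S) auto
  show thesis
  proof
    show "0 \<le> (d - c) / 2" using SI(3) by simp
    show "span_seminorm A f = ennreal ((d - c) / 2)"
      by (simp add: span_seminorm_def SI e2ennreal_ereal)
    fix y assume "y \<in> A"
    then show "ereal c \<le> f y \<and> f y \<le> ereal (c + 2 * ((d - c) / 2))"
      using INF_lower[of y A f] SUP_upper[of y A f] SI by (auto simp: field_simps)
  qed
qed

text \<open>Here \<open>h\<close> is the error \<open>dR[\<pi>\<^sub>t] - dR[empirical] - r\<^sub>t\<close>: the first-order variation at the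
  empirical measure, which need not be measurable, cancels.\<close>

lemma mirror_descent_step:
  fixes \<nu> :: "'y measure" and pref ps p q d :: "'y \<Rightarrow> real"
  assumes pol: "pref \<in> policies \<nu>" "ps \<in> policies \<nu>" "p \<in> policies \<nu>" "q \<in> policies \<nu>"
    and pos: "0 < \<beta>" "0 < L"
    and fin: "KL (law \<nu> ps) (law \<nu> pref) \<noteq> \<infinity>" "KL (law \<nu> ps) (law \<nu> p) \<noteq> \<infinity>"
    and d [measurable]: "d \<in> borel_measurable \<nu>"
    and int: "integrable \<nu> (\<lambda>y. p y * d y)" "integrable \<nu> (\<lambda>y. q y * d y)"
      "integrable \<nu> (\<lambda>y. ps y * d y)"
    and supp: "\<And>y. y \<in> space \<nu> \<Longrightarrow> q y = 0 \<longleftrightarrow> pref y = 0 \<or> p y = 0"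
    and h_def: "h = (\<lambda>y. d y - \<beta> * ln (q y / pref y) - L * ln (q y / p y))"
    and h: "\<And>y. y \<in> space \<nu> \<Longrightarrow> q y \<noteq> 0 \<Longrightarrow> h y \<in> {a..b}"
    and upper: "Rs \<le> Rp + pairing \<nu> d (\<lambda>y. ps y - p y)"
    and lower: "ereal Rq \<ge> ereal (Rp + pairing \<nu> d (\<lambda>y. q y - p y)) - ereal L * KL (law \<nu> q) (law \<nu> p)"
  obtains k ks k0 k1 where
    "KL (law \<nu> ps) (law \<nu> q) = ereal k" "KL (law \<nu> q) (law \<nu> pref) = ereal ks"
    "KL (law \<nu> ps) (law \<nu> p) = ereal k0" "KL (law \<nu> ps) (law \<nu> pref) = ereal k1"
    "Rs - Rq + \<beta> * ks - \<beta> * k1 + (L + \<beta> / 2) * k \<le> L * k0 + (b - a)\<^sup>2 / (4 * \<beta>)"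
proof -
  note [measurable] = pol[THEN policiesD(1)]
  note nonneg = pol[THEN policiesD(2)]
  have [measurable]: "h \<in> borel_measurable \<nu>" unfolding h_def by measurable
  have qh: "integrable \<nu> (\<lambda>y. q y * h y)"
    by (rule integrable_mult_bounded_on_support[OF pol(4)]) (use h in auto)
  \<comment> \<open>Finite divergence of \<open>ps\<close> from \<open>pref\<close> and from
    \<open>p\<close> makes \<open>ps\<close> vanish where either of them does, which by
    \<open>supp\<close> is exactly where \<open>q\<close> vanishes.\<close>
  have ac_q: "AE y in \<nu>. q y = 0 \<longrightarrow> ps y = 0"
    using KL_law_finite(1)[OF pol(2,1) fin(1)] KL_law_finite(1)[OF pol(2,3) fin(2)] AE_space
    by eventually_elim (use supp in auto)
  have sh: "integrable \<nu> (\<lambda>y. ps y * h y)"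
  proof (rule integrable_mult_bounded_on_support[OF pol(2)])
    show "AE y in \<nu>. ps y \<noteq> 0 \<longrightarrow> h y \<in> {a..b}"
      using ac_q AE_space by eventually_elim (use h in auto)
  qed measurable

  let ?kr = "\<lambda>y. q y * ln (q y / pref y)" and ?kp = "\<lambda>y. q y * ln (q y / p y)"
  let ?sr = "\<lambda>y. ps y * ln (ps y / pref y)" and ?sp = "\<lambda>y. ps y * ln (ps y / p y)"
  let ?sq = "\<lambda>y. ps y * ln (ps y / q y)"
  have kr_ge: "q y - pref y \<le> ?kr y" and kp_ge: "q y - p y \<le> ?kp y" if "y \<in> space \<nu>" for y
    using that nonneg supp by (intro mult_ln_ge; auto)+
  have sum_q: "\<beta> * ?kr y + L * ?kp y = q y * d y - q y * h y" for y
    by (simp add: h_def algebra_simps)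
  \<comment> \<open>At first only the combination in \<open>sum_q\<close> is known to be integrable.
    Both of its terms have integrable lower bounds, \<open>kr_ge\<close> and \<open>kp_ge\<close>,
    so the first term is also bounded above by an integrable function; the second then follows by
    subtraction.\<close>
  have kr: "integrable \<nu> ?kr"
  proof (rule Bochner_Integration.integrable_bound)
    show "integrable \<nu> (\<lambda>y. \<bar>q y - pref y\<bar> + \<bar>(q y * d y - q y * h y - L * (q y - p y)) / \<beta>\<bar>)"
      using pol[THEN policy_integrable(1)] int qh by auto
    show "AE y in \<nu>. norm (?kr y) \<le>
        norm (\<bar>q y - pref y\<bar> + \<bar>(q y * d y - q y * h y - L * (q y - p y)) / \<beta>\<bar>)"
    proof (rule AE_I2)
      fix y assume y: "y \<in> space \<nu>"
      have "\<beta> * ?kr y \<le> q y * d y - q y * h y - L * (q y - p y)"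
        using sum_q[of y] mult_left_mono[OF kp_ge[OF y] less_imp_le[OF pos(2)]] by linarith
      then have "?kr y \<le> (q y * d y - q y * h y - L * (q y - p y)) / \<beta>"
        using pos by (simp add: pos_le_divide_eq mult.commute)
      with kr_ge[OF y] show "norm (?kr y) \<le>
        norm (\<bar>q y - pref y\<bar> + \<bar>(q y * d y - q y * h y - L * (q y - p y)) / \<beta>\<bar>)"
        unfolding real_norm_def by linarith
    qed
  qed measurable
  have kp: "integrable \<nu> ?kp"
  proof -
    have "integrable \<nu> (\<lambda>y. (q y * d y - q y * h y - \<beta> * ?kr y) / L)"
      using int qh kr by auto
    then show ?thesis
      using pos by (simp add: sum_q[symmetric])
  qed
  note sr = KL_law_finite[OF pol(2,1) fin(1)] and sp = KL_law_finite[OF pol(2,3) fin(2)]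
  \<comment> \<open>Three-point identity at a single response: where \<open>ps\<close> is positive,
    \<open>(\<beta> + L) * ln (ps / q)\<close> equals
    \<open>\<beta> * ln (ps / pref) + L * ln (ps / p) - d + h\<close>.\<close>
  have sum_s: "AE y in \<nu>. ?sq y = (\<beta> * ?sr y + L * ?sp y - ps y * d y + ps y * h y) / (\<beta> + L)"
    using ac_q AE_space
  proof eventually_elim
    case (elim y)
    show ?case
    proof (cases "ps y = 0")
      case False
      with elim nonneg supp have gt: "0 < ps y" "0 < q y" "0 < pref y" "0 < p y"
        by (auto simp: less_le)
      have "(\<beta> + L) * ?sq y = \<beta> * ?sr y + L * ?sp y - ps y * d y + ps y * h y"
        using gt by (simp add: h_def ln_div algebra_simps)
      then show ?thesis using pos by (simp add: eq_divide_eq mult.commute)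
    qed simp
  qed
  have rhs: "integrable \<nu> (\<lambda>y. (\<beta> * ?sr y + L * ?sp y - ps y * d y + ps y * h y) / (\<beta> + L))"
    using sr(2) sp(2) int sh by auto
  have sq: "integrable \<nu> ?sq"
    using rhs by (subst integrable_cong_AE[OF _ _ sum_s]) measurable
  have ac_pref: "AE y in \<nu>. pref y = 0 \<longrightarrow> q y = 0" and ac_p: "AE y in \<nu>. p y = 0 \<longrightarrow> q y = 0"
    using supp by auto
  have KL_sq: "KL (law \<nu> ps) (law \<nu> q) = ereal (\<integral>y. ?sq y \<partial>\<nu>)"
    and KL_kr: "KL (law \<nu> q) (law \<nu> pref) = ereal (\<integral>y. ?kr y \<partial>\<nu>)"
    and KL_kp: "KL (law \<nu> q) (law \<nu> p) = ereal (\<integral>y. ?kp y \<partial>\<nu>)"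
    using ac_q ac_pref ac_p sq kr kp by (simp_all add: KL_law pol)

  have "(\<integral>y. ?sq y \<partial>\<nu>) = (\<integral>y. (\<beta> * ?sr y + L * ?sp y - ps y * d y + ps y * h y) / (\<beta> + L) \<partial>\<nu>)"
    by (rule integral_cong_AE[OF _ _ sum_s]) measurable
  also have "\<dots> = (\<beta> * (\<integral>y. ?sr y \<partial>\<nu>) + L * (\<integral>y. ?sp y \<partial>\<nu>) - (\<integral>y. ps y * d y \<partial>\<nu>) + (\<integral>y. ps y * h y \<partial>\<nu>)) / (\<beta> + L)"
    using sr(2) sp(2) int sh by simp
  finally have I1: "(\<beta> + L) * (\<integral>y. ?sq y \<partial>\<nu>) =
      \<beta> * (\<integral>y. ?sr y \<partial>\<nu>) + L * (\<integral>y. ?sp y \<partial>\<nu>) - (\<integral>y. ps y * d y \<partial>\<nu>) + (\<integral>y. ps y * h y \<partial>\<nu>)"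
    using pos by (simp add: field_simps)
  have "(\<integral>y. \<beta> * ?kr y + L * ?kp y \<partial>\<nu>) = (\<integral>y. q y * d y - q y * h y \<partial>\<nu>)"
    by (simp only: sum_q)
  then have I2: "\<beta> * (\<integral>y. ?kr y \<partial>\<nu>) + L * (\<integral>y. ?kp y \<partial>\<nu>) = (\<integral>y. q y * d y \<partial>\<nu>) - (\<integral>y. q y * h y \<partial>\<nu>)"
    using kr kp int qh by simp
  have pair: "pairing \<nu> d (\<lambda>y. f y - p y) = (\<integral>y. f y * d y \<partial>\<nu>) - (\<integral>y. p y * d y \<partial>\<nu>)"
    if "integrable \<nu> (\<lambda>y. f y * d y)" for f
    using that int(1) by (simp add: pairing_def algebra_simps)
  have "Rs \<le> Rp + (\<integral>y. ps y * d y \<partial>\<nu>) - (\<integral>y. p y * d y \<partial>\<nu>)"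
    using upper int by (simp add: pair)
  moreover have "Rq \<ge> Rp + (\<integral>y. q y * d y \<partial>\<nu>) - (\<integral>y. p y * d y \<partial>\<nu>) - L * (\<integral>y. ?kp y \<partial>\<nu>)"
    using lower int by (simp add: pair KL_kp)
  moreover have "(\<integral>y. ps y * h y \<partial>\<nu>) - (\<integral>y. q y * h y \<partial>\<nu>) \<le> \<beta> / 2 * (\<integral>y. ?sq y \<partial>\<nu>) + (b - a)\<^sup>2 / (4 * \<beta>)"
  proof -
    \<comment> \<open>With \<open>l = 2 / \<beta>\<close>, multiplying by \<open>\<beta> / 2\<close>
      leaves the divergence on the right with coefficient \<open>\<beta> / 2\<close>, at the price
      \<open>(b - a)\<^sup>2 / (4 * \<beta>)\<close>.\<close>
    have "2 / \<beta> * ((\<integral>y. ps y * h y \<partial>\<nu>) - (\<integral>y. q y * h y \<partial>\<nu>)) \<le>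
        (\<integral>y. ?sq y \<partial>\<nu>) + (2 / \<beta>)\<^sup>2 * (b - a)\<^sup>2 / 8"
      by (rule integral_diff_le_KL[OF pol(2,4) _ _ ac_q sq]) (use h pos in auto)
    from mult_left_mono[OF this, of "\<beta> / 2"] pos
    have "\<beta> / 2 * (2 / \<beta> * ((\<integral>y. ps y * h y \<partial>\<nu>) - (\<integral>y. q y * h y \<partial>\<nu>))) \<le>
        \<beta> / 2 * (\<integral>y. ?sq y \<partial>\<nu>) + \<beta> / 2 * ((2 / \<beta>)\<^sup>2 * (b - a)\<^sup>2 / 8)"
      by (simp add: distrib_left)
    moreover have "\<beta> / 2 * (2 / \<beta> * x) = x" "\<beta> / 2 * ((2 / \<beta>)\<^sup>2 * x / 8) = x / (4 * \<beta>)" for x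
      using pos by (simp_all add: field_simps power2_eq_square)
    ultimately show ?thesis by (simp only:)
  qed
  \<comment> \<open>The smoothness loss \<open>L * KL[q | p]\<close> is replaced through
    \<open>I2\<close>, which also supplies \<open>\<beta> * KL[q | pref]\<close>. The identity
    \<open>I1\<close> supplies \<open>(\<beta> + L) * KL[ps | q]\<close>, and the error pairing
    consumes \<open>\<beta> / 2\<close> of its coefficient.\<close>
  ultimately have "Rs - Rq + \<beta> * (\<integral>y. ?kr y \<partial>\<nu>) - \<beta> * (\<integral>y. ?sr y \<partial>\<nu>) + (L + \<beta> / 2) * (\<integral>y. ?sq y \<partial>\<nu>)
      \<le> L * (\<integral>y. ?sp y \<partial>\<nu>) + (b - a)\<^sup>2 / (4 * \<beta>)"
    using I1 I2 by (simp add: algebra_simps)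
  then show thesis
    using that KL_sq KL_kr sr(3) sp(3) by blast
qed

text \<open>If \<open>q\<close> vanishes at a point of the domain, both log ratios are
  \<open>- \<infinity>\<close>; if \<open>q\<close> is positive, a vanishing \<open>pref\<close> or
  \<open>p\<close> gives \<open>\<infinity>\<close>. The infinite terms thus never have opposite
  signs, and a finite residual forces all three densities to be positive.\<close>

lemma residual_finite:
  assumes "y \<in> residual_dom \<nu> pref p q" "0 < \<beta>" "0 < \<eta>"
    and "0 \<le> q y" "0 \<le> pref y" "0 \<le> p y"
    and "\<bar>residual g \<beta> \<eta> pref p q y\<bar> \<noteq> \<infinity>"
  shows "0 < q y" "0 < pref y" "0 < p y"
    and "residual g \<beta> \<eta> pref p q y =
      ereal (- g y + \<beta> * ln (q y / pref y) + 1 / \<eta> * ln (q y / p y))"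
proof -
  have "0 < q y \<and> 0 < pref y \<and> 0 < p y"
    using assms by (auto simp: residual_def log_ratio_def residual_dom_def split: if_splits)
  then show "0 < q y" "0 < pref y" "0 < p y"
    and "residual g \<beta> \<eta> pref p q y =
      ereal (- g y + \<beta> * ln (q y / pref y) + 1 / \<eta> * ln (q y / p y))"
    by (auto simp: residual_def log_ratio_def)
qed

lemma KL_law_nonneg:
  assumes "p \<in> policies \<nu>" "q \<in> policies \<nu>"
  shows "0 \<le> KL (law \<nu> p) (law \<nu> q)"
  by (simp add: KL_law_nn_integral[OF assms])

lemma KL_law_self:
  assumes "p \<in> policies \<nu>"
  shows "KL (law \<nu> p) (law \<nu> p) = 0"
proof -
  have "(\<lambda>y. p y * ln (p y / p y)) = (\<lambda>_. 0)" by auto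
  then show ?thesis by (simp only: KL_law[OF assms assms]) (simp add: zero_ereal_def)
qed

text \<open>The competitor \<open>pref\<close> has divergence 0 from itself, hence a finite
  objective, which bounds that of the minimizer.\<close>

lemma minimizer_KL_finite:
  assumes "is_minimizer \<nu> R \<beta> pref ps" "pref \<in> policies \<nu>" "0 < \<beta>"
  shows "KL (law \<nu> ps) (law \<nu> pref) \<noteq> \<infinity>"
proof
  assume "KL (law \<nu> ps) (law \<nu> pref) = \<infinity>"
  moreover have "objective \<nu> R \<beta> pref ps \<le> objective \<nu> R \<beta> pref pref"
    using assms by (auto simp: is_minimizer_def)
  ultimately show False
    using assms(3) by (simp add: objective_def KL_law_self[OF assms(2)])
qed

text \<open>An infinite error or an infinite \<open>KL[ps | p]\<close> makes the right-hand side
  infinite. Otherwise the finite residual ties the supports together and confines the error function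
  to an interval, as \<open>mirror_descent_step\<close> requires. The inequality holds for each
  outcome of the samples, before any expectation is taken.\<close>

lemma objective_step:
  fixes \<nu> :: "'y measure" and pref ps p q :: "'y \<Rightarrow> real"
  assumes fov: "first_order_variation \<nu> R dR" and pos: "0 < L" "0 < \<beta>"
    and conc: "concave_functional \<nu> R dR" and smooth: "KL_smooth \<nu> L R dR"
    and min: "is_minimizer \<nu> R \<beta> pref ps"
    and pol: "pref \<in> policies \<nu>" "p \<in> policies \<nu>" "q \<in> policies \<nu>"
  shows "e2ennreal (objective \<nu> R \<beta> pref q - objective \<nu> R \<beta> pref ps)
      + ennreal (L + \<beta> / 2) * e2ennreal (KL (law \<nu> ps) (law \<nu> q))
    \<le> ennreal L * e2ennreal (KL (law \<nu> ps) (law \<nu> p))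
      + ennreal (2 / \<beta>) * ((var_error \<nu> dR M ys p)\<^sup>2 + (opt_error \<nu> dR \<beta> (1 / L) pref M ys p q)\<^sup>2)"
    (is "_ \<le> ?rhs")
proof (cases "var_error \<nu> dR M ys p = \<top> \<or> opt_error \<nu> dR \<beta> (1 / L) pref M ys p q = \<top> \<or>
    KL (law \<nu> ps) (law \<nu> p) = \<infinity>")
  case True
  then have "?rhs = \<top>"
    using pos by (auto simp: power2_eq_square ennreal_mult_top e2ennreal_infty)
  then show ?thesis by (simp only: top_greatest)
next
  case False
  have ps: "ps \<in> policies \<nu>" using min by (simp add: is_minimizer_def)
  note nonneg = pol[THEN policiesD(2)]
  define g where "g = dR (empirical \<nu> M ys)"
  define d where "d = dR (law \<nu> p)"
  let ?D = "residual_dom \<nu> pref p q"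
  have qsupp: "y \<in> ?D" if "y \<in> space \<nu>" "q y \<noteq> 0" for y
    using that nonneg by (auto simp: residual_dom_def less_le)
  \<comment> \<open>A density with integral 1 is nonzero somewhere; such a point shows that the sets
    on which the seminorms are taken are nonempty.\<close>
  have "(\<integral>y. q y \<partial>\<nu>) \<noteq> 0" using policy_integrable[OF pol(3)] by simp
  then obtain y0 where "y0 \<in> space \<nu>" "q y0 \<noteq> 0"
    by (metis Bochner_Integration.integral_cong integral_zero)
  then have ne: "space \<nu> \<noteq> {}" "?D \<noteq> {}" using qsupp by auto
  have err: "var_error \<nu> dR M ys p = span_seminorm (space \<nu>) (\<lambda>y. ereal (g y - d y))"
    "opt_error \<nu> dR \<beta> (1 / L) pref M ys p q = span_seminorm ?D (residual g \<beta> (1 / L) pref p q)"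
    by (simp_all add: var_error_def opt_error_def g_def d_def)
  then have fin_err: "span_seminorm (space \<nu>) (\<lambda>y. ereal (g y - d y)) \<noteq> \<top>"
    "span_seminorm ?D (residual g \<beta> (1 / L) pref p q) \<noteq> \<top>"
    using False by auto
  obtain c s where s: "0 \<le> s" "var_error \<nu> dR M ys p = ennreal s"
    and gd: "\<And>y. y \<in> space \<nu> \<Longrightarrow> ereal c \<le> ereal (g y - d y) \<and> ereal (g y - d y) \<le> ereal (c + 2 * s)"
    by (rule span_seminorm_finite[OF ne(1) fin_err(1), folded err(1)]) blast
  obtain c' s' where s': "0 \<le> s'" "opt_error \<nu> dR \<beta> (1 / L) pref M ys p q = ennreal s'"
    and r: "\<And>y. y \<in> ?D \<Longrightarrow> ereal c' \<le> residual g \<beta> (1 / L) pref p q y \<and>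
        residual g \<beta> (1 / L) pref p q y \<le> ereal (c' + 2 * s')"
    by (rule span_seminorm_finite[OF ne(2) fin_err(2), folded err(2)]) blast
  have D: "0 < q y" "0 < pref y" "0 < p y"
    "residual g \<beta> (1 / L) pref p q y = ereal (- g y + \<beta> * ln (q y / pref y) + L * ln (q y / p y))"
    if "y \<in> ?D" for y
  proof -
    have y: "y \<in> space \<nu>" using that by (simp add: residual_dom_def)
    have fin: "\<bar>residual g \<beta> (1 / L) pref p q y\<bar> \<noteq> \<infinity>"
      using r[OF that] by (cases "residual g \<beta> (1 / L) pref p q y") auto
    show "0 < q y" "0 < pref y" "0 < p y"
      "residual g \<beta> (1 / L) pref p q y = ereal (- g y + \<beta> * ln (q y / pref y) + L * ln (q y / p y))"
      using residual_finite[OF that pos(2) _ nonneg(3)[OF y] nonneg(1)[OF y] nonneg(2)[OF y] fin] pos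
      by simp_all
  qed
  define h where "h = (\<lambda>y. d y - \<beta> * ln (q y / pref y) - L * ln (q y / p y))"
  have fov_int: "d \<in> borel_measurable \<nu>" "integrable \<nu> (\<lambda>y. f y * d y)" if "f \<in> policies \<nu>" for f
  proof -
    have int: "integrable (law \<nu> f) d"
      using fov that pol(2) by (auto simp: first_order_variation_def d_def)
    then show d: "d \<in> borel_measurable \<nu>"
      using borel_measurable_integrable by (fastforce simp: law_def)
    show "integrable \<nu> (\<lambda>y. f y * d y)"
      using int integrable_law_iff[OF that d] by simp
  qed
  \<comment> \<open>On \<open>?D\<close> all three densities are positive. At the remaining
    responses, by the definition of the domain, \<open>q\<close> vanishes together with
    \<open>pref\<close> or \<open>p\<close>.\<close>
  have supp: "q y = 0 \<longleftrightarrow> pref y = 0 \<or> p y = 0" if "y \<in> space \<nu>" for y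
    using D[of y] that nonneg[of y] by (force simp: residual_dom_def less_le)
  \<comment> \<open>Here \<open>h = - (g - d) - r\<close> with \<open>r\<close> the residual, so the
    lengths of the two intervals add up to \<open>2 * (s + s')\<close>.\<close>
  have h: "h y \<in> {- c - c' - 2 * (s + s')..- c - c'}" if "y \<in> space \<nu>" "q y \<noteq> 0" for y
    using gd[OF that(1)] r[OF qsupp[OF that]] unfolding D(4)[OF qsupp[OF that]] h_def by simp
  have upper: "R (law \<nu> ps) \<le> R (law \<nu> p) + pairing \<nu> d (\<lambda>y. ps y - p y)"
    using conc ps pol(2) by (simp add: concave_functional_def d_def)
  have lower: "ereal (R (law \<nu> q)) \<ge>
      ereal (R (law \<nu> p) + pairing \<nu> d (\<lambda>y. q y - p y)) - ereal L * KL (law \<nu> q) (law \<nu> p)"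
    using smooth pol(2,3) by (simp add: KL_smooth_def d_def)
  have fin: "KL (law \<nu> ps) (law \<nu> pref) \<noteq> \<infinity>" "KL (law \<nu> ps) (law \<nu> p) \<noteq> \<infinity>"
    using minimizer_KL_finite[OF min pol(1) pos(2)] False by auto
  obtain k ks k0 k1 where K:
    "KL (law \<nu> ps) (law \<nu> q) = ereal k" "KL (law \<nu> q) (law \<nu> pref) = ereal ks"
    "KL (law \<nu> ps) (law \<nu> p) = ereal k0" "KL (law \<nu> ps) (law \<nu> pref) = ereal k1"
    and le: "R (law \<nu> ps) - R (law \<nu> q) + \<beta> * ks - \<beta> * k1 + (L + \<beta> / 2) * k
      \<le> L * k0 + (- c - c' - (- c - c' - 2 * (s + s')))\<^sup>2 / (4 * \<beta>)"
    by (rule mirror_descent_step[OF pol(1) ps pol(2,3) pos(2,1) fin fov_int(1)[OF ps] fov_int(2)[OF pol(2)]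
          fov_int(2)[OF pol(3)] fov_int(2)[OF ps] supp h_def h upper lower])
  have "(- c - c' - (- c - c' - 2 * (s + s')))\<^sup>2 / (4 * \<beta>) = (s + s')\<^sup>2 / \<beta>"
    using pos by (simp add: power2_eq_square field_simps)
  \<comment> \<open>Separating the squares of the two errors produces the factor 2 in the error term
    of the final bound.\<close>
  also have "\<dots> \<le> 2 / \<beta> * (s\<^sup>2 + s'\<^sup>2)"
    using pos sum_squares_bound[of s s'] by (simp add: power2_sum divide_right_mono)
  finally have le': "R (law \<nu> ps) - R (law \<nu> q) + \<beta> * ks - \<beta> * k1 + (L + \<beta> / 2) * k
      \<le> L * k0 + 2 / \<beta> * (s\<^sup>2 + s'\<^sup>2)"
    using le by linarith
  have k_nonneg: "0 \<le> k" "0 \<le> k0"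
    using KL_law_nonneg[OF ps pol(3)] KL_law_nonneg[OF ps pol(2)] by (simp_all add: K)
  \<comment> \<open>Minimality ensures that \<open>e2ennreal\<close> does not truncate the
    gap.\<close>
  have "objective \<nu> R \<beta> pref ps \<le> objective \<nu> R \<beta> pref q"
    using min pol(3) by (simp add: is_minimizer_def)
  then have gap: "0 \<le> R (law \<nu> ps) - R (law \<nu> q) + \<beta> * ks - \<beta> * k1"
    by (simp add: objective_def K)
  have "e2ennreal (objective \<nu> R \<beta> pref q - objective \<nu> R \<beta> pref ps)
      + ennreal (L + \<beta> / 2) * e2ennreal (KL (law \<nu> ps) (law \<nu> q))
    = ennreal (R (law \<nu> ps) - R (law \<nu> q) + \<beta> * ks - \<beta> * k1 + (L + \<beta> / 2) * k)"
  proof -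
    have "objective \<nu> R \<beta> pref q - objective \<nu> R \<beta> pref ps
        = ereal (R (law \<nu> ps) - R (law \<nu> q) + \<beta> * ks - \<beta> * k1)"
      by (simp add: objective_def K)
    then show ?thesis
      using gap k_nonneg pos by (simp add: K e2ennreal_ereal ennreal_mult[symmetric] ennreal_plus[symmetric] del: ennreal_plus)
  qed
  also have "\<dots> \<le> ennreal (L * k0 + 2 / \<beta> * (s\<^sup>2 + s'\<^sup>2))"
    using le' by (rule ennreal_leI)
  also have "\<dots> = ?rhs"
    using s s' k_nonneg pos
    by (simp add: K e2ennreal_ereal ennreal_mult[symmetric] ennreal_plus[symmetric] ennreal_power del: ennreal_plus)
  finally show ?thesis .
qed

section \<open>Weighted summation, conditioning, independence and measurability\<close>

lemma telescoping_weighted_sum: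
  fixes x k :: "nat \<Rightarrow> ennreal"
  assumes step: "\<And>t. t < T \<Longrightarrow> x (Suc t) + L * r * k (Suc t) \<le> L * k t + c" and "n \<le> T"
  shows "(\<Sum>t=1..n. r ^ t * x t) + L * r ^ Suc n * k n \<le> L * r * k 0 + (\<Sum>t=1..n. r ^ t) * c"
  using \<open>n \<le> T\<close>
\<comment> \<open>Multiplied by \<open>r ^ Suc t\<close>, the hypothesis telescopes in
  \<open>L * r ^ Suc t * k t\<close>. Values may be infinite and cannot be subtracted, so the last
  such term stays on the left and carries the induction.\<close>
proof (induction n)
  case (Suc n)
  have "(\<Sum>t=1..Suc n. r ^ t * x t) + L * r ^ Suc (Suc n) * k (Suc n) =
      (\<Sum>t=1..n. r ^ t * x t) + r ^ Suc n * (x (Suc n) + L * r * k (Suc n))"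
    by (simp add: algebra_simps)
  also have "\<dots> \<le> (\<Sum>t=1..n. r ^ t * x t) + r ^ Suc n * (L * k n + c)"
    using Suc.prems by (intro add_left_mono mult_left_mono step) auto
  also have "\<dots> = ((\<Sum>t=1..n. r ^ t * x t) + L * r ^ Suc n * k n) + r ^ Suc n * c"
    by (simp add: algebra_simps)
  also have "\<dots> \<le> (L * r * k 0 + (\<Sum>t=1..n. r ^ t) * c) + r ^ Suc n * c"
    using Suc by (intro add_right_mono) auto
  finally show ?case by (simp add: algebra_simps)
qed simp

text \<open>Tower property: a conditional expectation has the same integral as the function. This
  turns the error bounds given the current policy into unconditional ones.\<close>

lemma (in prob_space) nn_integral_le_of_nn_cond_exp_le:
  assumes sub: "subalgebra M G" and f: "f \<in> borel_measurable M"
    and le: "AE x in M. nn_cond_exp M G f x \<le> c"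
  shows "(\<integral>\<^sup>+ x. f x \<partial>M) \<le> c"
proof -
  interpret finite_measure_subalgebra M G
    using sub by unfold_locales
  have "(\<integral>\<^sup>+ x. f x \<partial>M) = (\<integral>\<^sup>+ x. nn_cond_exp M G f x \<partial>M)"
    using nn_cond_exp_intg[of "\<lambda>_. 1" f] f by simp
  also have "\<dots> \<le> (\<integral>\<^sup>+ x. c \<partial>M)"
    using le by (rule nn_integral_mono_AE)
  finally show ?thesis by (simp add: emeasure_space_1)
qed

text \<open>Restricted to \<open>F\<close>, the measure with density \<open>indicator B\<close> is
  \<open>M\<close> scaled by the probability of \<open>B\<close>; on sets this is independence. The
  integral of an \<open>F\<close>-measurable function sees only this restriction.\<close>

lemma (in prob_space) nn_integral_mult_indicator_indep:
  assumes sub: "subalgebra M F" and indep: "indep_set (sets F) G"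
    and f: "f \<in> borel_measurable F" and B: "B \<in> G"
  shows "(\<integral>\<^sup>+ x. f x * indicator B x \<partial>M) = (\<integral>\<^sup>+ x. f x \<partial>M) * emeasure M B"
proof -
  have BM: "B \<in> sets M"
    using B indep_setD_ev2[OF indep] by blast
  have fM: "f \<in> borel_measurable M"
    by (rule measurable_from_subalg[OF sub f])
  let ?D = "density M (indicator B)"
  have subD: "subalgebra ?D F"
    using sub by (simp add: subalgebra_def)
  have "restr_to_subalg ?D F = scale_measure (emeasure M B) (restr_to_subalg M F)"
  proof (rule measure_eqI)
    fix A assume "A \<in> sets (restr_to_subalg ?D F)"
    then have A: "A \<in> sets F" "A \<in> sets M"
      using subD sub by (auto simp: sets_restr_to_subalg subalgebra_def)
    have "emeasure ?D A = emeasure M (A \<inter> B)"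
      using A BM by (simp add: emeasure_density indicator_inter_arith[symmetric] Int_commute mult.commute)
    also have "\<dots> = emeasure M B * emeasure M A"
      using indep_setD[OF indep A(1) B] by (simp add: emeasure_eq_measure ennreal_mult' mult.commute)
    finally show "emeasure (restr_to_subalg ?D F) A = emeasure (scale_measure (emeasure M B) (restr_to_subalg M F)) A"
      using A by (simp add: emeasure_restr_to_subalg[OF subD] emeasure_restr_to_subalg[OF sub])
  qed (simp add: sets_restr_to_subalg[OF subD] sets_restr_to_subalg[OF sub])
  then have "(\<integral>\<^sup>+ x. f x \<partial>restr_to_subalg ?D F) = emeasure M B * (\<integral>\<^sup>+ x. f x \<partial>restr_to_subalg M F)"
    using f measurable_in_subalg[OF sub f] by (simp add: nn_integral_scale_measure)
  then show ?thesis
    using f fM BM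
    by (simp add: nn_integral_subalgebra2[OF subD] nn_integral_subalgebra2[OF sub] nn_integral_density mult.commute)
qed

text \<open>The mass of a set is a parameter integral of the jointly measurable density, hence
  measurable by Tonelli. This makes \<open>sigma_policy\<close> a sub-sigma-algebra, so that
  conditioning on a policy is meaningful.\<close>

lemma measurable_law:
  assumes "sigma_finite_measure \<nu>"
    and [measurable]: "(\<lambda>(\<omega>, y). p \<omega> y) \<in> borel_measurable (N \<Otimes>\<^sub>M \<nu>)"
    and pol: "\<And>\<omega>. \<omega> \<in> space N \<Longrightarrow> p \<omega> \<in> policies \<nu>"
  shows "(\<lambda>\<omega>. law \<nu> (p \<omega>)) \<in> measurable N (prob_algebra \<nu>)"
proof (intro measurable_prob_algebraI measurable_subprob_algebra)
  interpret sigma_finite_measure \<nu> by fact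
  fix \<omega> assume "\<omega> \<in> space N"
  then show "prob_space (law \<nu> (p \<omega>))" by (intro policiesD pol)
  then show "subprob_space (law \<nu> (p \<omega>))" by (rule prob_space_imp_subprob_space)
next
  interpret sigma_finite_measure \<nu> by fact
  fix A assume A [measurable]: "A \<in> sets \<nu>"
  have "(\<lambda>\<omega>. \<integral>\<^sup>+ y. ennreal (p \<omega> y) * indicator A y \<partial>\<nu>) \<in> borel_measurable N"
    by measurable
  moreover have "emeasure (law \<nu> (p \<omega>)) A = (\<integral>\<^sup>+ y. ennreal (p \<omega> y) * indicator A y \<partial>\<nu>)"
    if "\<omega> \<in> space N" for \<omega>
    using policiesD(1)[OF pol[OF that]] A by (simp add: law_def emeasure_density)
  ultimately show "(\<lambda>\<omega>. emeasure (law \<nu> (p \<omega>)) A) \<in> borel_measurable N"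
    by (simp cong: measurable_cong)
qed (simp add: law_def)

lemma measurable_KL_law:
  assumes "sigma_finite_measure \<nu>"
    and [measurable]: "(\<lambda>(\<omega>, y). p \<omega> y) \<in> borel_measurable (N \<Otimes>\<^sub>M \<nu>)"
      "(\<lambda>(\<omega>, y). q \<omega> y) \<in> borel_measurable (N \<Otimes>\<^sub>M \<nu>)"
    and pol: "\<And>\<omega>. \<omega> \<in> space N \<Longrightarrow> p \<omega> \<in> policies \<nu>" "\<And>\<omega>. \<omega> \<in> space N \<Longrightarrow> q \<omega> \<in> policies \<nu>"
  shows "(\<lambda>\<omega>. KL (law \<nu> (p \<omega>)) (law \<nu> (q \<omega>))) \<in> borel_measurable N"
proof -
  interpret sigma_finite_measure \<nu> by fact
  have "(\<lambda>\<omega>. enn2ereal (\<integral>\<^sup>+ y. kl_fun (p \<omega> y) (q \<omega> y) \<partial>\<nu>)) \<in> borel_measurable N"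
    by measurable
  then show ?thesis
    by (simp add: KL_law_nn_integral pol cong: measurable_cong)
qed

lemma sum_power_from_1:
  fixes x :: real
  assumes "x \<noteq> 1"
  shows "(\<Sum>t=1..n. x ^ t) = x * (x ^ n - 1) / (x - 1)"
  using assms by (induction n) (simp_all add: field_simps)

section \<open>Expectations along the process and averaging over the random index\<close>

theorem theorem5p3:
  fixes \<nu> :: "'y measure"
    and R :: "'y measure \<Rightarrow> real"
    and dR :: "'y measure \<Rightarrow> 'y \<Rightarrow> real"
    and L \<beta> \<eta> \<epsilon> \<delta> :: real
    and pref pstar p0 :: "'y \<Rightarrow> real"
    and T M :: nat
    and Pr :: "'w measure"
    and F :: "nat \<Rightarrow> 'w measure"
    and \<pi> :: "nat \<Rightarrow> 'w \<Rightarrow> 'y \<Rightarrow> real"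
    and Y :: "nat \<Rightarrow> 'w \<Rightarrow> nat \<Rightarrow> 'y"
    and \<tau> :: "'w \<Rightarrow> nat"
  assumes "sigma_finite_measure \<nu>"
    and "first_order_variation \<nu> R dR"
    and "L > 0"
    and "concave_functional \<nu> R dR"
    and "KL_smooth \<nu> L R dR"
    and "\<beta> > 0"
    and "pref \<in> policies \<nu>"
    and "is_minimizer \<nu> R \<beta> pref pstar"
    and "T \<ge> 1" and "M \<ge> 1"
    and "p0 \<in> policies \<nu>"
    and "\<eta> = 1 / L"
    and "\<epsilon> \<ge> 0" and "\<delta> \<ge> 0"
    and "prob_space Pr"
    and "sampling_process Pr F \<nu> M T p0 \<pi> Y"
    \<comment> \<open>the reward and the two errors are random variables\<close>
    and "\<And>t. t \<le> T \<Longrightarrow> (\<lambda>\<omega>. R (law \<nu> (\<pi> t \<omega>))) \<in> borel_measurable (F t)"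
    and "\<And>t. t < T \<Longrightarrow> (\<lambda>\<omega>. var_error \<nu> dR M (Y t \<omega>) (\<pi> t \<omega>)) \<in> borel_measurable Pr"
    and "\<And>t. t < T \<Longrightarrow>
      (\<lambda>\<omega>. opt_error \<nu> dR \<beta> \<eta> pref M (Y t \<omega>) (\<pi> t \<omega>) (\<pi> (Suc t) \<omega>)) \<in> borel_measurable Pr"
    \<comment> \<open>the error bounds, conditionally on the current policy\<close>
    and "\<And>t. t < T \<Longrightarrow>
      AE \<omega> in Pr. nn_cond_exp Pr (sigma_policy Pr \<nu> (\<pi> t))
        (\<lambda>\<omega>. (var_error \<nu> dR M (Y t \<omega>) (\<pi> t \<omega>))\<^sup>2) \<omega> \<le> ennreal \<epsilon>"
    and "\<And>t. t < T \<Longrightarrow>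
      AE \<omega> in Pr. nn_cond_exp Pr (sigma_policy Pr \<nu> (\<pi> t))
        (\<lambda>\<omega>. (opt_error \<nu> dR \<beta> \<eta> pref M (Y t \<omega>) (\<pi> t \<omega>) (\<pi> (Suc t) \<omega>))\<^sup>2) \<omega> \<le> ennreal \<delta>"
    \<comment> \<open>the random index\<close>
    and "\<tau> \<in> measurable Pr (count_space UNIV)"
    and "\<And>\<omega>. \<omega> \<in> space Pr \<Longrightarrow> \<tau> \<omega> \<in> {1..T}"
    and "\<And>t. t \<in> {1..T} \<Longrightarrow> measure Pr {\<omega> \<in> space Pr. \<tau> \<omega> = t} =
      ((L + \<beta> / 2) / L) ^ t / (\<Sum>s = 1..T. ((L + \<beta> / 2) / L) ^ s)"
    and "prob_space.indep_set Pr (sets (F T))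
      (sets (vimage_algebra (space Pr) \<tau> (count_space UNIV)))"
  \<comment> \<open>the integrand is nonnegative because \<open>pstar\<close> is a minimizer\<close>
  shows "enn2ereal (\<integral>\<^sup>+ \<omega>. e2ennreal (objective \<nu> R \<beta> pref (\<pi> (\<tau> \<omega>) \<omega>) - objective \<nu> R \<beta> pref pstar) \<partial>Pr)
    \<le> ereal (\<beta> / 2) * KL (law \<nu> pstar) (law \<nu> p0) / ereal (((L + \<beta> / 2) / L) ^ T - 1)
      + ereal (2 * (\<epsilon> + \<delta>) / \<beta>)"
proof -
  interpret sigma_finite_measure \<nu> by fact
  interpret Pr: prob_space Pr by fact
  note proc = \<open>sampling_process Pr F \<nu> M T p0 \<pi> Y\<close>[unfolded sampling_process_def]
  have ps: "pstar \<in> policies \<nu>"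
    using \<open>is_minimizer \<nu> R \<beta> pref pstar\<close> by (simp add: is_minimizer_def)
  have subF: "subalgebra Pr (F t)" for t using proc by blast
  have spF: "space (F t) = space Pr" for t using subF[of t] by (simp add: subalgebra_def)
  have subFT: "subalgebra (F T) (F t)" if "t \<le> T" for t
    using proc that spF unfolding filtration_def subalgebra_def by auto
  have pol: "\<pi> t \<omega> \<in> policies \<nu>" if "t \<le> T" "\<omega> \<in> space Pr" for t \<omega>
    using proc that by blast
  have joint: "(\<lambda>(\<omega>, y). \<pi> t \<omega> y) \<in> borel_measurable (F t \<Otimes>\<^sub>M \<nu>)" if "t \<le> T" for t
    using proc that by blast
  have const: "(\<lambda>(\<omega>, y). p y) \<in> borel_measurable (F t \<Otimes>\<^sub>M \<nu>)" if "p \<in> policies \<nu>" for p t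
    using policiesD(1)[OF that] by measurable

  define obj where "obj = objective \<nu> R \<beta> pref pstar"
  define X where "X t \<omega> = e2ennreal (objective \<nu> R \<beta> pref (\<pi> t \<omega>) - obj)" for t \<omega>
  define K where "K t \<omega> = e2ennreal (KL (law \<nu> pstar) (law \<nu> (\<pi> t \<omega>)))" for t \<omega>
  define A where "A t \<omega> = (var_error \<nu> dR M (Y t \<omega>) (\<pi> t \<omega>))\<^sup>2" for t \<omega>
  define B where "B t \<omega> = (opt_error \<nu> dR \<beta> \<eta> pref M (Y t \<omega>) (\<pi> t \<omega>) (\<pi> (Suc t) \<omega>))\<^sup>2" for t \<omega>

  \<comment> \<open>Measurability is established for the history \<open>F t\<close> and not just for
    \<open>Pr\<close>, because the random index is assumed independent of
    \<open>F T\<close>.\<close>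
  have XF: "X t \<in> borel_measurable (F t)" and KF: "K t \<in> borel_measurable (F t)" if "t \<le> T" for t
  proof -
    have [measurable]: "(\<lambda>\<omega>. KL (law \<nu> (\<pi> t \<omega>)) (law \<nu> pref)) \<in> borel_measurable (F t)"
      "(\<lambda>\<omega>. KL (law \<nu> pstar) (law \<nu> (\<pi> t \<omega>))) \<in> borel_measurable (F t)"
      using that pol spF \<open>pref \<in> policies \<nu>\<close> ps
      by (auto intro!: measurable_KL_law \<open>sigma_finite_measure \<nu>\<close> joint const)
    have [measurable]: "(\<lambda>\<omega>. R (law \<nu> (\<pi> t \<omega>))) \<in> borel_measurable (F t)"
      using that by fact
    show "X t \<in> borel_measurable (F t)" "K t \<in> borel_measurable (F t)"
      unfolding X_def K_def objective_def by measurable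
  qed
  have [measurable]: "X t \<in> borel_measurable Pr" "K t \<in> borel_measurable Pr" if "t \<le> T" for t
    using that measurable_from_subalg[OF subF XF] measurable_from_subalg[OF subF KF] by auto
  have [measurable]: "A t \<in> borel_measurable Pr" "B t \<in> borel_measurable Pr" if "t < T" for t
    using assms(18,19)[OF that] unfolding A_def B_def by measurable
  have sub: "subalgebra Pr (sigma_policy Pr \<nu> (\<pi> t))" if "t \<le> T" for t
  proof -
    have "(\<lambda>\<omega>. law \<nu> (\<pi> t \<omega>)) \<in> measurable (F t) (prob_algebra \<nu>)"
      using that pol spF by (intro measurable_law \<open>sigma_finite_measure \<nu>\<close> joint) auto
    then have "(\<lambda>\<omega>. law \<nu> (\<pi> t \<omega>)) \<in> measurable Pr (prob_algebra \<nu>)"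
      by (rule measurable_from_subalg[OF subF])
    then show ?thesis
      unfolding sigma_policy_def subalgebra_def by (simp add: sets_image_in_sets)
  qed
  have EA: "(\<integral>\<^sup>+\<omega>. A t \<omega> \<partial>Pr) \<le> ennreal \<epsilon>" and EB: "(\<integral>\<^sup>+\<omega>. B t \<omega> \<partial>Pr) \<le> ennreal \<delta>" if "t < T" for t
    using that assms(20,21)[OF that] unfolding A_def[symmetric] B_def[symmetric]
    by (auto intro!: Pr.nn_integral_le_of_nn_cond_exp_le[OF sub[of t]])

  define \<rho> where "\<rho> = (L + \<beta> / 2) / L"
  define c where "c = 2 * (\<epsilon> + \<delta>) / \<beta>"
  define x where "x t = (\<integral>\<^sup>+\<omega>. X t \<omega> \<partial>Pr)" for t
  define k where "k t = (\<integral>\<^sup>+\<omega>. K t \<omega> \<partial>Pr)" for t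
  have \<rho>: "1 < \<rho>" "L * \<rho> = L + \<beta> / 2"
    using \<open>L > 0\<close> \<open>\<beta> > 0\<close> by (simp_all add: \<rho>_def field_simps)
  have "0 \<le> c" using assms(6,13,14) by (simp add: c_def)
  have step: "x (Suc t) + ennreal L * ennreal \<rho> * k (Suc t) \<le> ennreal L * k t + ennreal c" if "t < T" for t
  proof -
    have [measurable]: "X (Suc t) \<in> borel_measurable Pr" "K (Suc t) \<in> borel_measurable Pr"
      "K t \<in> borel_measurable Pr" "A t \<in> borel_measurable Pr" "B t \<in> borel_measurable Pr"
      using that by simp_all
    have "x (Suc t) + ennreal L * ennreal \<rho> * k (Suc t)
        = (\<integral>\<^sup>+\<omega>. X (Suc t) \<omega> + ennreal (L + \<beta> / 2) * K (Suc t) \<omega> \<partial>Pr)"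
      using \<rho> \<open>L > 0\<close> by (simp add: x_def k_def nn_integral_add nn_integral_cmult ennreal_mult[symmetric])
    also have "\<dots> \<le> (\<integral>\<^sup>+\<omega>. ennreal L * K t \<omega> + ennreal (2 / \<beta>) * (A t \<omega> + B t \<omega>) \<partial>Pr)"
    proof (rule nn_integral_mono)
      fix \<omega> assume \<omega>: "\<omega> \<in> space Pr"
      show "X (Suc t) \<omega> + ennreal (L + \<beta> / 2) * K (Suc t) \<omega>
          \<le> ennreal L * K t \<omega> + ennreal (2 / \<beta>) * (A t \<omega> + B t \<omega>)"
        unfolding X_def K_def A_def B_def obj_def \<open>\<eta> = 1 / L\<close>
        using that \<omega> assms(2-8) pol by (intro objective_step) auto
    qed
    also have "\<dots> = ennreal L * k t + ennreal (2 / \<beta>) * ((\<integral>\<^sup>+\<omega>. A t \<omega> \<partial>Pr) + (\<integral>\<^sup>+\<omega>. B t \<omega> \<partial>Pr))"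
      by (simp add: k_def nn_integral_add nn_integral_cmult)
    also have "\<dots> \<le> ennreal L * k t + ennreal (2 / \<beta>) * (ennreal \<epsilon> + ennreal \<delta>)"
      by (intro add_mono mult_left_mono EA EB that) auto
    also have "ennreal (2 / \<beta>) * (ennreal \<epsilon> + ennreal \<delta>) = ennreal c"
      using assms(6,13,14) by (simp add: c_def ennreal_mult[symmetric] ennreal_plus[symmetric] del: ennreal_plus)
    finally show ?thesis .
  qed
  define S where "S = (\<Sum>s = 1..T. \<rho> ^ s)"
  have S: "S = \<rho> * (\<rho> ^ T - 1) / (\<rho> - 1)"
    unfolding S_def using \<rho>(1) by (intro sum_power_from_1) simp
  have "1 < \<rho> ^ T" using \<rho> \<open>T \<ge> 1\<close> by (intro one_less_power) auto
  then have "0 < S" using \<rho> by (simp add: S)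
  define C where "C = \<beta> / 2 / (\<rho> ^ T - 1)"
  have "0 \<le> C" using \<open>1 < \<rho> ^ T\<close> \<open>\<beta> > 0\<close> by (simp add: C_def)
  have tele: "(\<Sum>t=1..T. ennreal (\<rho> ^ t) * x t) \<le> ennreal (L * \<rho>) * k 0 + ennreal S * ennreal c"
  proof -
    \<comment> \<open>The divergence from the last iterate is nonnegative and is only inserted to
      match the telescoped form.\<close>
    have "(\<Sum>t=1..T. ennreal \<rho> ^ t * x t) \<le> (\<Sum>t=1..T. ennreal \<rho> ^ t * x t) + ennreal L * ennreal \<rho> ^ Suc T * k T"
      by simp
    also have "\<dots> \<le> ennreal L * ennreal \<rho> * k 0 + (\<Sum>t=1..T. ennreal \<rho> ^ t) * ennreal c"
      by (rule telescoping_weighted_sum[where T = T]) (use step in auto)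
    finally show ?thesis
      using \<rho>(1) \<open>L > 0\<close> by (simp add: S_def ennreal_power ennreal_mult)
  qed

  let ?E = "\<lambda>t. {\<omega> \<in> space Pr. \<tau> \<omega> = t}"
  have EG: "?E t \<in> sets (vimage_algebra (space Pr) \<tau> (count_space UNIV))" for t
    using in_vimage_algebra[of "{t}" "count_space UNIV" \<tau> "space Pr"] by (simp add: vimage_def Int_def conj_commute)
  have [measurable]: "?E t \<in> sets Pr" for t
    using \<open>\<tau> \<in> measurable Pr (count_space UNIV)\<close> by measurable
  \<comment> \<open>Splitting by the value of the index leaves finitely many deterministic times, at
    each of which independence factors the integral.\<close>
  have "(\<integral>\<^sup>+\<omega>. X (\<tau> \<omega>) \<omega> \<partial>Pr) = (\<integral>\<^sup>+\<omega>. (\<Sum>t=1..T. X t \<omega> * indicator (?E t) \<omega>) \<partial>Pr)"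
  proof (rule nn_integral_cong)
    fix \<omega> assume "\<omega> \<in> space Pr"
    then have "(\<Sum>t=1..T. X t \<omega> * indicator (?E t) \<omega>) = (\<Sum>t\<in>{1..T}. if \<tau> \<omega> = t then X t \<omega> else 0)"
      by (intro sum.cong) auto
    then show "X (\<tau> \<omega>) \<omega> = (\<Sum>t=1..T. X t \<omega> * indicator (?E t) \<omega>)"
      using assms(23)[OF \<open>\<omega> \<in> space Pr\<close>] by simp
  qed
  also have "\<dots> = (\<Sum>t=1..T. (\<integral>\<^sup>+\<omega>. X t \<omega> * indicator (?E t) \<omega> \<partial>Pr))"
    by (rule nn_integral_sum) simp
  also have "\<dots> = (\<Sum>t=1..T. x t * emeasure Pr (?E t))"
    unfolding x_def using measurable_from_subalg[OF subFT XF] EG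
    by (intro sum.cong refl Pr.nn_integral_mult_indicator_indep[OF subF assms(25)]) auto
  also have "\<dots> = (\<Sum>t=1..T. ennreal (1 / S) * (ennreal (\<rho> ^ t) * x t))"
  proof (rule sum.cong)
    fix t assume t: "t \<in> {1..T}"
    have "measure Pr (?E t) = \<rho> ^ t / S"
      using assms(24)[OF t] unfolding \<rho>_def[symmetric] S_def[symmetric] .
    then have "emeasure Pr (?E t) = ennreal (1 / S) * ennreal (\<rho> ^ t)"
      using \<rho>(1) \<open>0 < S\<close> by (simp add: Pr.emeasure_eq_measure ennreal_mult[symmetric])
    then show "x t * emeasure Pr (?E t) = ennreal (1 / S) * (ennreal (\<rho> ^ t) * x t)"
      by (simp add: mult_ac)
  qed simp
  also have "\<dots> \<le> ennreal (1 / S) * (ennreal (L * \<rho>) * k 0 + ennreal S * ennreal c)"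
    unfolding sum_distrib_left[symmetric] by (intro mult_left_mono tele) simp
  also have "\<dots> = ennreal C * k 0 + ennreal c"
  proof -
    \<comment> \<open>By the geometric sum,
      \<open>L * \<rho> / S = L * (\<rho> - 1) / (\<rho> ^ T - 1)\<close>, and
      \<open>L * (\<rho> - 1) = \<beta> / 2\<close>.\<close>
    have "1 / S * (L * \<rho>) = (L * \<rho> - L) / (\<rho> ^ T - 1)"
      using \<rho>(1) \<open>1 < \<rho> ^ T\<close> by (simp add: S field_simps)
    then have "1 / S * (L * \<rho>) = C"
      by (simp add: \<rho>(2) C_def)
    moreover have "ennreal (1 / S) * (ennreal (L * \<rho>) * k 0 + ennreal S * ennreal c)
        = ennreal (1 / S * (L * \<rho>)) * k 0 + ennreal (1 / S * S) * ennreal c"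
    proof -
      have "ennreal (1 / S * (L * \<rho>)) = ennreal (1 / S) * ennreal (L * \<rho>)"
        "ennreal (1 / S * S) = ennreal (1 / S) * ennreal S"
        by (rule ennreal_mult; use \<rho>(1) \<open>0 < S\<close> \<open>L > 0\<close> in simp)+
      then show ?thesis by (simp only: distrib_left mult.assoc)
    qed
    ultimately show ?thesis using \<open>0 < S\<close> by simp
  qed
  finally have le: "(\<integral>\<^sup>+\<omega>. X (\<tau> \<omega>) \<omega> \<partial>Pr) \<le> ennreal C * k 0 + ennreal c" .
  \<comment> \<open>The initial policy is deterministic, so this is the expectation of a
    constant.\<close>
  have "k 0 = (\<integral>\<^sup>+\<omega>. e2ennreal (KL (law \<nu> pstar) (law \<nu> p0)) \<partial>Pr)"
    unfolding k_def K_def using proc by (intro nn_integral_cong) auto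
  then have k0: "k 0 = e2ennreal (KL (law \<nu> pstar) (law \<nu> p0))"
    by (simp add: Pr.emeasure_space_1)
  show ?thesis
  proof (cases "KL (law \<nu> pstar) (law \<nu> p0)")
    case (real r)
    then have r: "0 \<le> r" using KL_law_nonneg[OF ps \<open>p0 \<in> policies \<nu>\<close>] by simp
    have "enn2ereal (\<integral>\<^sup>+\<omega>. X (\<tau> \<omega>) \<omega> \<partial>Pr) \<le> enn2ereal (ennreal C * k 0 + ennreal c)"
      using le by (simp add: less_eq_ennreal.rep_eq)
    also have "ennreal C * k 0 + ennreal c = ennreal (C * r + c)"
      using r \<open>0 \<le> c\<close> \<open>0 \<le> C\<close> by (simp add: k0 real e2ennreal_ereal ennreal_mult)
    also have "enn2ereal \<dots> = ereal (C * r + c)"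
      using r \<open>0 \<le> c\<close> \<open>0 \<le> C\<close> by (intro enn2ereal_ennreal) simp
    also have "\<dots> = ereal (\<beta> / 2) * KL (law \<nu> pstar) (law \<nu> p0) / ereal (\<rho> ^ T - 1) + ereal c"
      using \<open>1 < \<rho> ^ T\<close> by (simp add: real C_def)
    finally show ?thesis
      unfolding X_def obj_def \<rho>_def c_def .
  next
    \<comment> \<open>As \<open>\<rho> ^ T - 1\<close> is positive and finite, the right-hand side
      is infinite and the bound is trivial.\<close>
    case PInf
    then show ?thesis
      using \<open>1 < \<rho> ^ T\<close> \<open>\<beta> > 0\<close> by (simp add: \<rho>_def[symmetric])
  next
    case MInf
    then show ?thesis using KL_law_nonneg[OF ps \<open>p0 \<in> policies \<nu>\<close>] by simp
  qed
qed

end
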